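(* Let $T$ be an even integer with $T\neq\pm 8$ and put $N=\frac{(T^2+64)(T-8)(T+8)}{16}$. If $(x,y)\in\mathbb{Z}^2$ satisfies $(x+y)^4-4x^2y^2+Txy(x+y)+4=0$, then there exists an integer divisor $d_1$ of $N$ such that $$(4x+4y)^2=d_1+\frac{N}{d_1}-\frac{T^2}{2}.$$ *)

theory Defs
  imports Complex_Main
begin

text \<open>For even \<open>T\<close> the quotients \<open>(T\<^sup>2 + 64) (T - 8) (T + 8) / 16\<close> and \<open>T\<^sup>2 / 2\<close> are exact, so
  writing them with integer \<open>div\<close> involves no rounding.\<close>

lemma sixteen_dvd_numerator:
  fixes T :: int
  assumes "even T"
  shows "16 dvd (T\<^sup>2 + 64) * (T - 8) * (T + 8)"
proof -
  obtain t where "T = 2 * t" using assms by (elim evenE)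
  then have "(T\<^sup>2 + 64) * (T - 8) * (T + 8) = 16 * ((t\<^sup>2 + 16) * (t - 4) * (t + 4))"
    by (simp add: algebra_simps power2_eq_square)
  then show ?thesis by simp
qed

lemma two_dvd_square:
  fixes T :: int
  assumes "even T"
  shows "2 dvd T\<^sup>2"
  using assms by simp

end

theory Submission
  imports Defs
begin

text \<open>With \<open>s = x + y\<close>, \<open>p = x y\<close> and \<open>w = 8 p - T s\<close>, completing the square in \<open>p\<close> turns the
  equation into \<open>w\<^sup>2 = 16 s\<^sup>4 + T\<^sup>2 s\<^sup>2 + 64\<close>, and completing the square in \<open>s\<^sup>2\<close> turns this into
  \<open>(16 s\<^sup>2 + T\<^sup>2/2)\<^sup>2 - (4 w)\<^sup>2 = 4 N\<close>. Hence \<open>8 s\<^sup>2 + T\<^sup>2/4 \<plusminus> 2 w\<close> are complementary divisors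
  of \<open>N\<close> with sum \<open>16 s\<^sup>2 + T\<^sup>2/2\<close>.\<close>

theorem theorem4p2:
  fixes T N x y :: int
  assumes "even T" and "T \<noteq> 8" and "T \<noteq> -8"
    and "N = ((T\<^sup>2 + 64) * (T - 8) * (T + 8)) div 16"
    and "(x + y) ^ 4 - 4 * x\<^sup>2 * y\<^sup>2 + T * x * y * (x + y) + 4 = 0"
  shows "\<exists>d\<^sub>1::int. d\<^sub>1 dvd N \<and> (4 * x + 4 * y)\<^sup>2 = d\<^sub>1 + N div d\<^sub>1 - T\<^sup>2 div 2"
proof -
  obtain t where T: "T = 2 * t" using \<open>even T\<close> by (elim evenE)
  define s p where "s = x + y" and "p = x * y"
  define w where "w = 8 * p - T * s"
  \<comment> \<open>\<open>t\<^sup>2\<close> is \<open>T\<^sup>2 / 4\<close>, so halving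
    \<open>T\<close> keeps both factors integral.\<close>
  define d e where "d = 8 * s\<^sup>2 + t\<^sup>2 + 2 * w" and "e = 8 * s\<^sup>2 + t\<^sup>2 - 2 * w"
  have "(T\<^sup>2 + 64) * (T - 8) * (T + 8) = 16 * ((t\<^sup>2 + 16) * (t - 4) * (t + 4))"
    unfolding T by (simp add: algebra_simps power2_eq_square)
  then have N: "N = (t\<^sup>2 + 16) * (t - 4) * (t + 4)"
    using assms(4) by simp
  have eq: "s ^ 4 - 4 * p\<^sup>2 + 2 * t * p * s + 4 = 0"
    using assms(5) by (simp add: s_def p_def T power_mult_distrib mult.assoc)
  \<comment> \<open>A polynomial identity in \<open>s\<close>, \<open>p\<close>, \<open>t\<close>;
    the curve equation \<open>eq\<close> then makes the right side vanish.\<close>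
  have "d * e - N = 64 * (s ^ 4 - 4 * p\<^sup>2 + 2 * t * p * s + 4)"
    unfolding d_def e_def w_def N T by algebra
  then have de: "N = d * e" using eq by simp
  have "t\<^sup>2 + 16 \<noteq> 0"
    using zero_le_power2[of t] by linarith
  \<comment> \<open>The linear factors vanish only at \<open>T = 8\<close> and
    \<open>T = -8\<close>. As \<open>N = d * e\<close>, this gives \<open>d \<noteq> 0\<close>, so
    \<open>div\<close> cancels \<open>d\<close>.\<close>
  then have "N \<noteq> 0"
    using assms(2,3) by (auto simp: N T)
  then have "N div d = e" using de by simp
  \<comment> \<open>The \<open>w\<close> terms cancel in \<open>d + e\<close>, and
    \<open>T\<^sup>2 div 2\<close> is exactly \<open>2 * t\<^sup>2\<close>.\<close>
  moreover have "(4 * x + 4 * y)\<^sup>2 = d + e - T\<^sup>2 div 2"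
    by (simp add: d_def e_def s_def T power2_eq_square algebra_simps)
  ultimately show ?thesis using de by (intro exI[of _ d]) simp
qed

end
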